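(* Let $T>0$, $I=[0,T]$ and $x\in\mathcal{C}^1(I)$. The operator $\mathscr{V}_{1,1}$, obtained from the memory-weighted velocity operator $\mathscr{V}_{\alpha,\beta}$ by setting $\alpha(t)\equiv\beta(t)\equiv 1$, is given by $$\mathscr{V}_{1,1}[x](t)=\frac{\int_0^t [x(t)-x(\tau)]\,d\tau}{\int_0^t (t-\tau)\,d\tau}\quad (t\in(0,T]),\qquad \mathscr{V}_{1,1}[x](0)=\dot{x}(0),$$ and it satisfies $$\lim_{t\to 0^+}\mathscr{V}_{1,1}[x](t)=\dot{x}(0).$$
   Context: $\mathcal{C}^1(I)$ is the space of continuously differentiable real-valued functions on $I=[0,T]$ (one-sided derivatives at the endpoints). A time-varying memory exponent is a continuous function $\varrho:I\to\mathbb{R}$ with $\varrho(t)\in(0,1]$ for all $t\in I$. Its memory kernel is $K_\varrho(t,\tau)=\frac{(t-\tau)^{\varrho(t)-1}}{\Gamma(\varrho(t))}$ for $0\le\tau<t\le T$, and $K_\varrho(t,\tau)=0$ for $\tau\ge t$, where $\Gamma$ is the Gamma function. For memory exponents $\alpha,\beta$ and $x\in\mathcal{C}^1(I)$, the memory-weighted velocity operator is the function $\mathscr{V}_{\alpha,\beta}[x]:I\to\mathbb{R}$ given by $$\mathscr{V}_{\alpha,\beta}[x](t)=\frac{\int_0^t K_\alpha(t,\tau)\,[x(t)-x(\tau)]\,d\tau}{\int_0^t K_\beta(t,\tau)\,(t-\tau)\,d\tau}\quad (t\in(0,T]),\qquad \mathscr{V}_{\alpha,\beta}[x](0)=\dot{x}(0).$$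 *)

theory Defs
  imports "HOL-Analysis.Analysis"
begin

(* Functions on I = [0,T] are total functions of type real => real; only their values on {0..T}
   matter. The derivative is taken within {0..T}, hence it is one-sided at the endpoints.
   (The library's C1_differentiable_on uses two-sided derivatives at every point of the set and
   would therefore depend on values outside I.) *)
definition derivI :: "real \<Rightarrow> (real \<Rightarrow> real) \<Rightarrow> real \<Rightarrow> real" where
  "derivI T x t = vector_derivative x (at t within {0..T})"

definition C1I :: "real \<Rightarrow> (real \<Rightarrow> real) \<Rightarrow> bool" where
  "C1I T x \<longleftrightarrow> x differentiable_on {0..T} \<and> continuous_on {0..T} (derivI T x)"

definition memory_exponent :: "real \<Rightarrow> (real \<Rightarrow> real) \<Rightarrow> bool" where
  "memory_exponent T \<rho> \<longleftrightarrow> continuous_on {0..T} \<rho> \<and> (\<forall>t\<in>{0..T}. \<rho> t \<in> {0<..1})"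

lemma memory_exponent_one: "memory_exponent T (\<lambda>_. 1)"
  by (simp add: memory_exponent_def)

definition memory_kernel :: "(real \<Rightarrow> real) \<Rightarrow> real \<Rightarrow> real \<Rightarrow> real" where
  "memory_kernel \<rho> t \<tau> = (if \<tau> < t then (t - \<tau>) powr (\<rho> t - 1) / Gamma (\<rho> t) else 0)"

(* Intended for memory exponents \<alpha>, \<beta>, for C1I T x, and for t in {0..T}. *)
definition velocity_op ::
  "real \<Rightarrow> (real \<Rightarrow> real) \<Rightarrow> (real \<Rightarrow> real) \<Rightarrow> (real \<Rightarrow> real) \<Rightarrow> real \<Rightarrow> real" where
  "velocity_op T \<alpha> \<beta> x t =
    (if t = 0 then derivI T x 0
     else integral {0..t} (\<lambda>\<tau>. memory_kernel \<alpha> t \<tau> * (x t - x \<tau>)) /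
          integral {0..t} (\<lambda>\<tau>. memory_kernel \<beta> t \<tau> * (t - \<tau>)))"

end

theory Submission
  imports Defs
begin

text \<open>Differentiability at \<open>0\<close> gives
  \<open>x t - x \<tau> = D * (t - \<tau>) + o(t)\<close> uniformly in \<open>0 \<le> \<tau> \<le> t\<close>; integrating over
  \<open>\<tau>\<close> leaves an error \<open>o(t\<^sup>2)\<close>, which is negligible against the denominator \<open>t\<^sup>2 / 2\<close>.\<close>

text \<open>At exponent 1 the kernel is \<open>(t - \<tau>) powr 0 / Gamma 1\<close>, which is 1 for
  \<open>\<tau> < t\<close> and 0 at \<open>\<tau> = t\<close>. The vanishing of \<open>f\<close> at
  \<open>t\<close> makes the integrands agree at that endpoint too.\<close>

lemma integral_memory_kernel_one:
  assumes "f t = 0"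
  shows "integral {0..t} (\<lambda>\<tau>. memory_kernel (\<lambda>_. 1) t \<tau> * f \<tau>) = integral {0..t} f"
  by (rule integral_cong) (use assms in \<open>auto simp: memory_kernel_def\<close>)

lemma velocity_op_one:
  assumes "t \<noteq> 0"
  shows "velocity_op T (\<lambda>_. 1) (\<lambda>_. 1) x t =
    integral {0..t} (\<lambda>\<tau>. x t - x \<tau>) / integral {0..t} (\<lambda>\<tau>. t - \<tau>)"
  using assms by (simp add: velocity_op_def integral_memory_kernel_one)

lemma integral_linear_lag:
  fixes t :: real
  assumes "0 \<le> t"
  shows "integral {0..t} (\<lambda>\<tau>. t - \<tau>) = t\<^sup>2 / 2"
proof -
  \<comment> \<open>The value stays unsimplified so that unification can read off the antiderivative
    \<open>t * \<tau> - \<tau>\<^sup>2 / 2\<close> from its values at \<open>t\<close> and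
    \<open>0\<close>.\<close>
  have "((\<lambda>\<tau>. t - \<tau>) has_integral (t * t - t\<^sup>2 / 2) - (t * 0 - 0\<^sup>2 / 2)) {0..t}"
    using assms
    by (intro fundamental_theorem_of_calculus)
       (auto intro!: derivative_eq_intros simp flip: has_real_derivative_iff_has_vector_derivative)
  then show ?thesis
    by (simp add: integral_unique power2_eq_square)
qed

lemma averaged_increment_tendsto_derivative:
  fixes x :: "real \<Rightarrow> real"
  assumes T: "T > 0" and cont: "continuous_on {0..T} x"
    and der: "(x has_vector_derivative D) (at 0 within {0..T})"
  shows "((\<lambda>t. integral {0..t} (\<lambda>\<tau>. x t - x \<tau>) / integral {0..t} (\<lambda>\<tau>. t - \<tau>)) \<longlongrightarrow> D)
    (at_right 0)"
proof (rule tendstoI)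
  fix e :: real
  assume e: "e > 0"
  \<comment> \<open>Two expansions at \<open>0\<close>, one for \<open>t\<close> and one for
    \<open>\<tau>\<close>, each contribute an error of at most \<open>e / 8 * t\<close>.\<close>
  then have "e / 8 > 0" by simp
  with der obtain d where d: "d > 0"
    and approx': "\<forall>y\<in>{0..T}. norm (y - 0) < d \<longrightarrow>
      norm (x y - x 0 - (y - 0) *\<^sub>R D) \<le> e / 8 * norm (y - 0)"
    unfolding has_vector_derivative_def has_derivative_within_alt by blast
  have approx: "\<bar>x y - x 0 - y * D\<bar> \<le> e / 8 * y" if "y \<in> {0..T}" "y < d" for y
    using approx'[rule_format, of y] that by simp
  \<comment> \<open>\<open>d\<close> makes the expansion at \<open>0\<close> available;
    \<open>T\<close> keeps \<open>{0..t}\<close> inside the domain of \<open>x\<close>.\<close>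
  have "dist (integral {0..t} (\<lambda>\<tau>. x t - x \<tau>) / integral {0..t} (\<lambda>\<tau>. t - \<tau>)) D < e"
    if t: "0 < t" "t < min d T" for t
  proof -
    have cont_t: "continuous_on {0..t} x"
      using cont by (rule continuous_on_subset) (use t in auto)
    \<comment> \<open>Subtracting the two expansions cancels \<open>x 0\<close>; since
      \<open>\<tau> \<le> t\<close>, the bound is uniform in \<open>\<tau>\<close>.\<close>
    have bound: "\<bar>(x t - x \<tau>) - D * (t - \<tau>)\<bar> \<le> e / 4 * t" if \<tau>: "\<tau> \<in> {0..t}" for \<tau>
    proof -
      have "\<bar>(x t - x \<tau>) - D * (t - \<tau>)\<bar> \<le> \<bar>x t - x 0 - t * D\<bar> + \<bar>x \<tau> - x 0 - \<tau> * D\<bar>"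
        by (simp add: algebra_simps abs_if)
      also have "\<dots> \<le> e / 8 * t + e / 8 * \<tau>"
        using t \<tau> by (intro add_mono approx) auto
      also have "\<dots> \<le> e / 4 * t"
        using e \<tau> by (simp add: field_simps)
      finally show ?thesis .
    qed
    have "\<bar>integral {0..t} (\<lambda>\<tau>. (x t - x \<tau>) - D * (t - \<tau>))\<bar> \<le> e / 4 * t * (t - 0)"
      unfolding real_norm_def[symmetric]
      using t bound by (intro integral_bound continuous_intros cont_t) auto
    also have "integral {0..t} (\<lambda>\<tau>. (x t - x \<tau>) - D * (t - \<tau>)) =
        integral {0..t} (\<lambda>\<tau>. x t - x \<tau>) - D * (t\<^sup>2 / 2)"
      using t
      by (subst integral_diff)
         (auto intro!: integrable_continuous_real continuous_intros cont_t simp: integral_linear_lag)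
    \<comment> \<open>The bound \<open>e / 4 * t\<close> times the interval length \<open>t\<close>
      is \<open>e / 2\<close> times the denominator; the spare factor 2 yields the strict
      inequality.\<close>
    finally have "\<bar>integral {0..t} (\<lambda>\<tau>. x t - x \<tau>) - D * (t\<^sup>2 / 2)\<bar> \<le> e / 2 * (t\<^sup>2 / 2)"
      by (simp add: power2_eq_square)
    also have "\<dots> < e * (t\<^sup>2 / 2)"
      using e t by simp
    finally have less: "\<bar>integral {0..t} (\<lambda>\<tau>. x t - x \<tau>) - D * (t\<^sup>2 / 2)\<bar> < e * (t\<^sup>2 / 2)" .
    have "integral {0..t} (\<lambda>\<tau>. x t - x \<tau>) / (t\<^sup>2 / 2) - D =
        (integral {0..t} (\<lambda>\<tau>. x t - x \<tau>) - D * (t\<^sup>2 / 2)) / (t\<^sup>2 / 2)"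
      using t by (simp add: field_simps)
    moreover have "\<bar>\<dots>\<bar> < e"
      using less t by (subst abs_divide) (simp add: pos_divide_less_eq)
    ultimately show ?thesis
      using t by (simp add: dist_real_def integral_linear_lag)
  qed
  then show "\<forall>\<^sub>F t in at_right 0.
      dist (integral {0..t} (\<lambda>\<tau>. x t - x \<tau>) / integral {0..t} (\<lambda>\<tau>. t - \<tau>)) D < e"
    unfolding eventually_at_right_field using d T by (intro exI[of _ "min d T"]) auto
qed

theorem theorem2p2:
  fixes T :: real and x :: "real \<Rightarrow> real"
  assumes "T > 0" and "C1I T x"
  shows "(\<forall>t\<in>{0<..T}. velocity_op T (\<lambda>_. 1) (\<lambda>_. 1) x t =
            integral {0..t} (\<lambda>\<tau>. x t - x \<tau>) / integral {0..t} (\<lambda>\<tau>. t - \<tau>)) \<and>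
         velocity_op T (\<lambda>_. 1) (\<lambda>_. 1) x 0 = derivI T x 0 \<and>
         (velocity_op T (\<lambda>_. 1) (\<lambda>_. 1) x \<longlongrightarrow> derivI T x 0) (at_right 0)"
proof (intro conjI ballI)
  show "velocity_op T (\<lambda>_. 1) (\<lambda>_. 1) x t =
      integral {0..t} (\<lambda>\<tau>. x t - x \<tau>) / integral {0..t} (\<lambda>\<tau>. t - \<tau>)" if "t \<in> {0<..T}" for t
    using that by (intro velocity_op_one) auto
  show "velocity_op T (\<lambda>_. 1) (\<lambda>_. 1) x 0 = derivI T x 0"
    by (simp add: velocity_op_def)
  have diff: "x differentiable_on {0..T}"
    using assms by (simp add: C1I_def)
  \<comment> \<open>\<open>vector_derivative\<close> is defined by choice; differentiability at
    \<open>0\<close> ensures that the chosen value is the one-sided derivative.\<close>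
  then have "(x has_vector_derivative derivI T x 0) (at 0 within {0..T})"
    using assms by (simp add: differentiable_on_def derivI_def vector_derivative_works[symmetric])
  then have "((\<lambda>t. integral {0..t} (\<lambda>\<tau>. x t - x \<tau>) / integral {0..t} (\<lambda>\<tau>. t - \<tau>))
      \<longlongrightarrow> derivI T x 0) (at_right 0)"
    using assms diff
    by (intro averaged_increment_tendsto_derivative differentiable_imp_continuous_on)
  \<comment> \<open>The operator equals the quotient at every \<open>t \<noteq> 0\<close>, so any
    right neighbourhood of \<open>0\<close> serves; the witness 1 is arbitrary.\<close>
  then show "(velocity_op T (\<lambda>_. 1) (\<lambda>_. 1) x \<longlongrightarrow> derivI T x 0) (at_right 0)"
    by (rule Lim_transform_eventually)
       (auto simp: velocity_op_one eventually_at_right_field intro!: exI[of _ 1])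
qed

end
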